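(* Let $p$ be a prime and $n$ a positive integer. Let ${\mathcal X}_1,\dots,{\mathcal X}_n\subseteq\mathbb{F}_p$ with $|{\mathcal X}_i|=X_i$, $X_1\ge X_2\ge\dots\ge X_n$, and $X_i\ge p^{1/2+1/(2^{n+1}-6)}$ for all $i$. Then $$|S({\mathcal X}_1,\dots,{\mathcal X}_n;\omega_1,\dots,\omega_n)|\ll_n X_1\cdots X_n\left(\sum_{i=1}^{n}\frac{1}{X_i^{1/2^{i}}}+p^{o(1)}\left(\frac{p^{1/2}}{(X_1\cdots X_n)^{1/n}}\right)^{1/2^n}\right).$$
   Context: $\mathbf{e}_p(u)=\exp(2\pi i u/p)$. For sets ${\mathcal X}_1,\dots,{\mathcal X}_n$ and complex weights $\omega_1,\dots,\omega_n$, where $\omega_i(\mathbf{x})$ is a function of $\mathbf{x}=(x_1,\dots,x_n)$ not depending on $x_i$ and satisfying $|\omega_i(\mathbf{x})|\le 1$, define $$S({\mathcal X}_1,\dots,{\mathcal X}_n;\omega_1,\dots,\omega_n)=\sum_{x_1\in{\mathcal X}_1}\cdots\sum_{x_n\in{\mathcal X}_n}\omega_1(\mathbf{x})\cdots\omega_n(\mathbf{x})\,\mathbf{e}_p(x_1\cdots x_n).$$ $A\ll_n B$ means $|A|\le c|B|$ with $c$ depending only on $n$; $p^{o(1)}$ denotes a factor $p^{\epsilon(p)}$ with $\epsilon(p)\to0$ as $p\to\infty$.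
   Formalization: Stated for n ≥ 2 instead of every positive n: for n = 1 the size condition is only X_1 ≥ 1 and the bound fails, e.g. for X_1 = {0,…,⌊p/8⌋} with weight 1, where |S| ≥ X_1/2 but the right side is o(X_1). *)

theory Defs
  imports Complex_Main "HOL-Library.FuncSet" "HOL-Number_Theory.Residues"
begin

text \<open>
  The field with \<open>p\<close> elements is \<open>carrier (residue_ring (int p))\<close>, i.e. the integers
  \<open>0, \<dots>, p - 1\<close>. The additive character \<open>e_p\<close> is defined on all integers; by the
  periodicity lemma below it does not matter whether a product is reduced modulo \<open>p\<close> before
  \<open>e_p\<close> is applied.
\<close>

definition e_p :: "nat \<Rightarrow> int \<Rightarrow> complex" where
  "e_p p u = exp (2 * complex_of_real pi * \<i> * of_int u / of_nat p)"

lemma e_p_mod: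
  assumes "p > 0"
  shows "e_p p (u mod int p) = e_p p u"
proof -
  have "real_of_int u = real_of_int (u div int p) * real p + real_of_int (u mod int p)"
    by (metis div_mult_mod_eq of_int_add of_int_mult of_int_of_nat_eq)
  hence *: "2 * pi * real_of_int u / real p =
      2 * pi * real_of_int (u div int p) + 2 * pi * real_of_int (u mod int p) / real p"
    using assms by (simp add: field_simps)
  have cis: "e_p p v = cis (2 * pi * real_of_int v / real p)" for v
    by (simp add: e_p_def cis_conv_exp mult_ac)
  show ?thesis
    unfolding cis * by (simp flip: cis_mult)
qed

text \<open>
  Points \<open>x = (x\<^sub>1, \<dots>, x\<^sub>n)\<close> of \<open>X\<^sub>1 \<times> \<dots> \<times> X\<^sub>n\<close> are extensional functions on \<open>{1..n}\<close>.
\<close>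

definition admissible_weights ::
    "nat \<Rightarrow> (nat \<Rightarrow> int set) \<Rightarrow> (nat \<Rightarrow> (nat \<Rightarrow> int) \<Rightarrow> complex) \<Rightarrow> bool" where
  "admissible_weights n X \<omega> \<longleftrightarrow>
     (\<forall>i\<in>{1..n}. \<forall>x\<in>PiE {1..n} X.
        cmod (\<omega> i x) \<le> 1 \<and> (\<forall>t\<in>X i. \<omega> i (x(i := t)) = \<omega> i x))"

definition multilinear_sum ::
    "nat \<Rightarrow> nat \<Rightarrow> (nat \<Rightarrow> int set) \<Rightarrow> (nat \<Rightarrow> (nat \<Rightarrow> int) \<Rightarrow> complex) \<Rightarrow> complex" where
  "multilinear_sum p n X \<omega> =
     (\<Sum>x\<in>PiE {1..n} X. (\<Prod>i=1..n. \<omega> i x) * e_p p (\<Prod>i=1..n. x i))"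

text \<open>
  The bound on \<open>multilinear_sum\<close> is stated for \<open>n \<ge> 2\<close>. For \<open>n = 1\<close> the size condition reads
  \<open>|X\<^sub>1| \<ge> p\<^sup>0 = 1\<close> and the bound fails: for \<open>X\<^sub>1 = {0..p div 8}\<close> and weight 1 the sum is at
  least \<open>|X\<^sub>1| / 2\<close>, while the right-hand side is \<open>|X\<^sub>1|\<close> times a quantity tending to 0.
\<close>

end

theory Submission
  imports Defs "HOL-Analysis.Analysis"
begin

text \<open>
  Cauchy--Schwarz in all variables but \<open>x\<^sub>n\<close> removes the weight \<open>\<omega>\<^sub>n\<close> and replaces the phase by
  \<open>(u - v) x\<^sub>1 \<cdots> x\<^sub>n\<^sub>-\<^sub>1\<close> with \<open>u, v \<in> X\<^sub>n\<close>; the diagonal \<open>u = v\<close> costs \<open>1 / |X\<^sub>n|\<close>, and off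
  the diagonal \<open>u - v\<close> is a unit, so one can induct. The induction ends at the bilinear sum over
  the two largest sets, where Parseval gives the relative saving \<open>(p / (|X\<^sub>1| |X\<^sub>2|))\<^sup>1\<^sup>/\<^sup>2\<close>. Since
  \<open>|X\<^sub>1| |X\<^sub>2|\<close> is at least the square of the geometric mean of all the sizes, this already beats
  the claimed main term, with no loss \<open>p\<^sup>o\<^sup>(\<^sup>1\<^sup>)\<close>.
\<close>

section \<open>Orthogonality of the additive characters modulo \<open>p\<close>\<close>

lemma e_p_cis: "e_p p u = cis (2 * pi * real_of_int u / real p)"
  by (simp add: e_p_def cis_conv_exp mult_ac)

lemma norm_e_p [simp]: "cmod (e_p p u) = 1"
  by (simp add: e_p_cis)

lemma e_p_mult_cnj: "e_p p u * cnj (e_p p v) = e_p p (u - v)"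
  by (simp add: e_p_cis cis_cnj cis_mult diff_divide_distrib right_diff_distrib)

lemma e_p_eq_1D:
  assumes "p > 0" "e_p p u = 1"
  shows "int p dvd u"
proof -
  have "exp (\<i> * of_real (2 * pi * real_of_int u / real p)) = 1"
    using assms(2) unfolding e_p_cis cis_conv_exp .
  then obtain m :: int where "2 * pi * real_of_int u / real p = of_int (2 * m) * pi"
    by (auto simp: exp_eq_1)
  hence "real_of_int u = of_int (m * int p)"
    using assms(1) by (simp add: field_simps)
  hence "u = m * int p"
    by (simp only: of_int_eq_iff)
  thus ?thesis by simp
qed

text \<open>A full geometric progression whose ratio \<open>e_p p a\<close> is a \<open>p\<close>-th
  root of unity, different from 1 because \<open>p\<close> does not divide \<open>a\<close>.\<close>

lemma sum_e_p_eq_0: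
  assumes "p > 0" "\<not> int p dvd a"
  shows "(\<Sum>x\<in>{0..<int p}. e_p p (a * x)) = 0"
proof -
  have pow: "e_p p (a * int j) = e_p p a ^ j" for j
    by (simp add: e_p_cis Complex.DeMoivre algebra_simps)
  have "e_p p (a * int p) = 1"
    using assms(1) e_p_mod[of p "a * int p"] by (simp add: e_p_def)
  hence "e_p p a ^ p = 1" by (simp flip: pow)
  have "(\<Sum>x\<in>{0..<int p}. e_p p (a * x)) = (\<Sum>j<p. e_p p (a * int j))"
    by (rule sum.reindex_bij_witness[of _ int nat]) auto
  also have "\<dots> = (\<Sum>j<p. e_p p a ^ j)" by (simp add: pow)
  also have "\<dots> = 0"
    using e_p_eq_1D[of p a] assms \<open>e_p p a ^ p = 1\<close> by (auto simp: sum_gp_strict)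
  finally show ?thesis .
qed

section \<open>Cauchy--Schwarz and correlations\<close>

lemma norm_sum_weighted_sq_le:
  fixes w F :: "'a \<Rightarrow> complex"
  assumes "\<And>x. x \<in> A \<Longrightarrow> cmod (w x) \<le> 1"
  shows "(cmod (\<Sum>x\<in>A. w x * F x))\<^sup>2 \<le> real (card A) * (\<Sum>x\<in>A. (cmod (F x))\<^sup>2)"
proof -
  have "cmod (\<Sum>x\<in>A. w x * F x) \<le> (\<Sum>x\<in>A. cmod (F x))"
    by (rule sum_norm_le) (use assms in \<open>auto simp: norm_mult mult_left_le_one_le\<close>)
  hence "(cmod (\<Sum>x\<in>A. w x * F x))\<^sup>2 \<le> (\<Sum>x\<in>A. 1 * cmod (F x))\<^sup>2"
    by (simp add: power_mono)
  also have "\<dots> \<le> (\<Sum>x\<in>A. 1\<^sup>2) * (\<Sum>x\<in>A. (cmod (F x))\<^sup>2)"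
    by (rule Cauchy_Schwarz_ineq_sum)
  finally show ?thesis by simp
qed

text \<open>Expand the square and move the sum over \<open>x\<close> innermost. The triangle
  inequality is applied only in \<open>u\<close> and \<open>v\<close>, so the cancellation in
  \<open>x\<close> survives.\<close>

lemma sum_norm_sq_le_correlations:
  fixes g :: "'a \<Rightarrow> 'b \<Rightarrow> complex"
  shows "(\<Sum>x\<in>A. (cmod (\<Sum>t\<in>T. g x t))\<^sup>2)
    \<le> (\<Sum>u\<in>T. \<Sum>v\<in>T. cmod (\<Sum>x\<in>A. g x u * cnj (g x v)))"
proof -
  have "complex_of_real (\<Sum>x\<in>A. (cmod (\<Sum>t\<in>T. g x t))\<^sup>2)
      = (\<Sum>x\<in>A. \<Sum>u\<in>T. \<Sum>v\<in>T. g x u * cnj (g x v))"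
    by (simp add: complex_norm_square sum_product del: of_real_power)
  also have "\<dots> = (\<Sum>u\<in>T. \<Sum>x\<in>A. \<Sum>v\<in>T. g x u * cnj (g x v))"
    by (rule sum.swap)
  also have "\<dots> = (\<Sum>u\<in>T. \<Sum>v\<in>T. \<Sum>x\<in>A. g x u * cnj (g x v))"
    by (intro sum.cong refl sum.swap)
  finally have eq: "complex_of_real (\<Sum>x\<in>A. (cmod (\<Sum>t\<in>T. g x t))\<^sup>2) = \<dots>" .
  \<comment> \<open>The expansion is an identity between complex numbers; its left side is a
    nonnegative real and hence equals its own norm.\<close>
  have "(\<Sum>x\<in>A. (cmod (\<Sum>t\<in>T. g x t))\<^sup>2)
      = cmod (complex_of_real (\<Sum>x\<in>A. (cmod (\<Sum>t\<in>T. g x t))\<^sup>2))"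
    by (simp only: norm_of_real) (simp add: sum_nonneg)
  also have "\<dots> \<le> (\<Sum>u\<in>T. \<Sum>v\<in>T. cmod (\<Sum>x\<in>A. g x u * cnj (g x v)))"
    unfolding eq by (intro sum_norm_le order.refl)
  finally show ?thesis .
qed

section \<open>Bilinear sums\<close>

lemma not_dvd_mult_diff:
  assumes "prime p" "\<not> int p dvd k" "u \<in> {0..<int p}" "v \<in> {0..<int p}" "u \<noteq> v"
  shows "\<not> int p dvd k * (u - v)"
proof -
  have "\<not> int p dvd u - v"
    using assms(3-5) by (auto simp: mod_eq_dvd_iff[symmetric])
  thus ?thesis
    using assms(1,2) prime_dvd_mult_iff[of "int p"] by simp
qed

text \<open>Cauchy--Schwarz removes \<open>a\<close>, and Parseval evaluates the mean square of the
  inner sum: over all residues, orthogonality leaves only \<open>u = v\<close>, each such pair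
  contributing at most \<open>p\<close>.\<close>

lemma bilinear_sum_bound:
  assumes p: "prime p" and k: "\<not> int p dvd k"
    and A: "A \<subseteq> {0..<int p}" and B: "B \<subseteq> {0..<int p}"
    and a: "\<And>x. x \<in> A \<Longrightarrow> cmod (a x) \<le> 1" and b: "\<And>y. y \<in> B \<Longrightarrow> cmod (b y) \<le> 1"
  shows "(cmod (\<Sum>x\<in>A. \<Sum>y\<in>B. a x * b y * e_p p (k * (x * y))))\<^sup>2
    \<le> real p * real (card A) * real (card B)"
proof -
  define F where "F x = (\<Sum>y\<in>B. b y * e_p p (k * (x * y)))" for x
  have p0: "p > 0" using p prime_gt_0_nat by blast
  have finB: "finite B" using B finite_subset by blast
  \<comment> \<open>Positivity allows \<open>x\<close> to run over all residues, which makes the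
    correlations complete sums.\<close>
  have "(\<Sum>x\<in>A. (cmod (F x))\<^sup>2) \<le> (\<Sum>x\<in>{0..<int p}. (cmod (F x))\<^sup>2)"
    by (intro sum_mono2) (use A in auto)
  also have "\<dots> \<le> (\<Sum>u\<in>B. \<Sum>v\<in>B. cmod (\<Sum>x\<in>{0..<int p}.
      b u * e_p p (k * (x * u)) * cnj (b v * e_p p (k * (x * v)))))"
    unfolding F_def by (rule sum_norm_sq_le_correlations)
  also have "\<dots> = (\<Sum>u\<in>B. \<Sum>v\<in>B. cmod (b u) * cmod (b v) *
      cmod (\<Sum>x\<in>{0..<int p}. e_p p (k * (u - v) * x)))"
  proof (intro sum.cong refl)
    fix u v
    have "b u * e_p p (k * (x * u)) * cnj (b v * e_p p (k * (x * v)))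
        = b u * cnj (b v) * e_p p (k * (u - v) * x)" for x
    proof -
      have "b u * e_p p (k * (x * u)) * cnj (b v * e_p p (k * (x * v)))
          = b u * cnj (b v) * (e_p p (k * (x * u)) * cnj (e_p p (k * (x * v))))"
        by simp
      thus ?thesis unfolding e_p_mult_cnj by (simp add: algebra_simps)
    qed
    thus "cmod (\<Sum>x\<in>{0..<int p}. b u * e_p p (k * (x * u)) * cnj (b v * e_p p (k * (x * v))))
        = cmod (b u) * cmod (b v) * cmod (\<Sum>x\<in>{0..<int p}. e_p p (k * (u - v) * x))"
      by (simp only: flip: sum_distrib_left) (simp add: norm_mult)
  qed
  also have "\<dots> \<le> (\<Sum>u\<in>B. \<Sum>v\<in>B. if v = u then real p else 0)"
  proof (intro sum_mono)
    fix u v assume uv: "u \<in> B" "v \<in> B"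
    show "cmod (b u) * cmod (b v) * cmod (\<Sum>x\<in>{0..<int p}. e_p p (k * (u - v) * x))
        \<le> (if v = u then real p else 0)"
    proof (cases "v = u")
      case True
      have "cmod (b u) * cmod (b v) \<le> 1" using b uv by (intro mult_le_one) auto
      thus ?thesis using True by (simp add: e_p_def mult_left_le_one_le)
    next
      case False
      hence "\<not> int p dvd k * (u - v)"
        using not_dvd_mult_diff[OF p k] uv B by blast
      thus ?thesis using False sum_e_p_eq_0[OF p0] by simp
    qed
  qed
  also have "\<dots> = real p * real (card B)"
    using finB by (simp add: sum.delta')
  finally have F: "(\<Sum>x\<in>A. (cmod (F x))\<^sup>2) \<le> real p * real (card B)" .
  have "(cmod (\<Sum>x\<in>A. \<Sum>y\<in>B. a x * b y * e_p p (k * (x * y))))\<^sup>2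
      = (cmod (\<Sum>x\<in>A. a x * F x))\<^sup>2"
    by (simp add: F_def sum_distrib_left mult.assoc)
  also have "\<dots> \<le> real (card A) * (\<Sum>x\<in>A. (cmod (F x))\<^sup>2)"
    by (rule norm_sum_weighted_sq_le) (rule a)
  also have "\<dots> \<le> real (card A) * (real p * real (card B))"
    by (intro mult_left_mono F) simp
  finally show ?thesis by (simp add: mult_ac)
qed

section \<open>Multilinear sums and the differencing step\<close>

lemma sum_PiE_Suc:
  fixes f :: "(nat \<Rightarrow> 'a) \<Rightarrow> 'b::comm_monoid_add"
  shows "(\<Sum>x\<in>PiE {1..Suc n} X. f x) = (\<Sum>x\<in>PiE {1..n} X. \<Sum>t\<in>X (Suc n). f (x(Suc n := t)))"
proof -
  have "PiE {1..Suc n} X = (\<lambda>(t, x). x(Suc n := t)) ` (X (Suc n) \<times> PiE {1..n} X)"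
    by (simp add: atLeastAtMostSuc_conv PiE_insert_eq)
  hence "(\<Sum>x\<in>PiE {1..Suc n} X. f x)
      = (\<Sum>(t, x)\<in>X (Suc n) \<times> PiE {1..n} X. f (x(Suc n := t)))"
    using inj_combinator[of "Suc n" "{1..n}" X]
    by (simp add: sum.reindex o_def case_prod_unfold)
  also have "\<dots> = (\<Sum>t\<in>X (Suc n). \<Sum>x\<in>PiE {1..n} X. f (x(Suc n := t)))"
    by (rule sum.cartesian_product[symmetric])
  also have "\<dots> = (\<Sum>x\<in>PiE {1..n} X. \<Sum>t\<in>X (Suc n). f (x(Suc n := t)))"
    by (rule sum.swap)
  finally show ?thesis .
qed

text \<open>The frequency \<open>k\<close> makes the family closed under differencing, which turns
  \<open>k\<close> into \<open>k * (u - v)\<close>. The original sum has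
  \<open>k = 1\<close>.\<close>

definition scaled_sum ::
    "nat \<Rightarrow> int \<Rightarrow> nat \<Rightarrow> (nat \<Rightarrow> int set) \<Rightarrow> (nat \<Rightarrow> (nat \<Rightarrow> int) \<Rightarrow> complex) \<Rightarrow> complex" where
  "scaled_sum p k n X \<omega> =
     (\<Sum>x\<in>PiE {1..n} X. (\<Prod>i=1..n. \<omega> i x) * e_p p (k * (\<Prod>i=1..n. x i)))"

lemma admissible_weightsD:
  assumes "admissible_weights n X \<omega>" "i \<in> {1..n}" "x \<in> PiE {1..n} X"
  shows "cmod (\<omega> i x) \<le> 1" and "t \<in> X i \<Longrightarrow> \<omega> i (x(i := t)) = \<omega> i x"
  using assms unfolding admissible_weights_def by blast+

lemma PiE_Suc_upd:
  assumes "x \<in> PiE {1..n} X" "t \<in> X (Suc n)"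
  shows "x(Suc n := t) \<in> PiE {1..Suc n} X"
  using assms by (auto simp: PiE_iff extensional_def)

text \<open>The trivial bound, for the diagonal \<open>u = v\<close>, where the new frequency is 0
  and no cancellation can be expected from the phase.\<close>

lemma norm_scaled_sum_le:
  assumes "admissible_weights n X \<omega>"
  shows "cmod (scaled_sum p k n X \<omega>) \<le> (\<Prod>i=1..n. real (card (X i)))"
proof -
  have "cmod (scaled_sum p k n X \<omega>) \<le> (\<Sum>x\<in>PiE {1..n} X. 1)"
    unfolding scaled_sum_def
  proof (rule sum_norm_le)
    fix x assume "x \<in> PiE {1..n} X"
    thus "cmod ((\<Prod>i=1..n. \<omega> i x) * e_p p (k * (\<Prod>i=1..n. x i))) \<le> 1"
      using admissible_weightsD(1)[OF assms]
      by (auto simp: norm_mult prod_norm[symmetric] intro!: prod_le_1)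
  qed
  thus ?thesis by (simp add: card_PiE)
qed

text \<open>With two variables, \<open>\<omega> 1\<close> depends only on the second coordinate and
  \<open>\<omega> 2\<close> only on the first, so the weights have the product form of the bilinear
  bound, with their roles exchanged.\<close>

lemma scaled_sum_2_bound:
  assumes p: "prime p" and k: "\<not> int p dvd k"
    and X: "\<And>i. i \<in> {1..2} \<Longrightarrow> X i \<subseteq> {0..<int p}"
    and w: "admissible_weights 2 X \<omega>" and ne: "X 1 \<noteq> {}" "X 2 \<noteq> {}"
  shows "(cmod (scaled_sum p k 2 X \<omega>))\<^sup>2 \<le> real p * real (card (X 1)) * real (card (X 2))"
proof -
  obtain s t where s: "s \<in> X 1" and t: "t \<in> X 2" using ne by auto
  \<comment> \<open>Points of the product are extensional, hence \<open>undefined\<close> away from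
    the coordinates 1 and 2.\<close>
  define P :: "int \<Rightarrow> int \<Rightarrow> nat \<Rightarrow> int" where "P a b = (\<lambda>_. undefined)(1 := a, 2 := b)" for a b
  have P: "P a b \<in> PiE {1..2} X" if "a \<in> X 1" "b \<in> X 2" for a b
    using that by (auto simp: P_def PiE_iff extensional_def numeral_2_eq_2 le_Suc_eq)
  have inv: "\<omega> i ((P a b)(i := c)) = \<omega> i (P a b)"
    if "a \<in> X 1" "b \<in> X 2" "i \<in> {1..2}" "c \<in> X i" for a b c i
    using admissible_weightsD(2)[OF w] P that by blast
  have le1: "cmod (\<omega> i (P a b)) \<le> 1" if "a \<in> X 1" "b \<in> X 2" "i \<in> {1..2}" for a b i
    using admissible_weightsD(1)[OF w] P that by blast
  \<comment> \<open>Freezing the irrelevant coordinate at \<open>s\<close> or \<open>t\<close>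
    exhibits each weight as a function of one variable.\<close>
  have inv1: "\<omega> 1 (P a b) = \<omega> 1 (P s b)" and inv2: "\<omega> 2 (P a b) = \<omega> 2 (P a t)"
    if "a \<in> X 1" "b \<in> X 2" for a b
    using inv[OF that, of 1 s] inv[OF that, of 2 t] s t
    by (auto simp: P_def fun_upd_twist)
  have "scaled_sum p k 2 X \<omega>
      = (\<Sum>a\<in>X 1. \<Sum>b\<in>X 2. \<omega> 1 (P a b) * \<omega> 2 (P a b) * e_p p (k * (a * b)))"
    unfolding scaled_sum_def numeral_2_eq_2 One_nat_def sum_PiE_Suc[unfolded One_nat_def]
    by (simp add: P_def fun_upd_def numeral_2_eq_2 prod.atLeast_Suc_atMost)
  also have "\<dots> = (\<Sum>a\<in>X 1. \<Sum>b\<in>X 2. \<omega> 2 (P a t) * \<omega> 1 (P s b) * e_p p (k * (a * b)))"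
    using inv1 inv2 by (intro sum.cong refl) (simp add: mult_ac)
  finally show ?thesis
    using bilinear_sum_bound[OF p k X X, of 1 2 "\<lambda>a. \<omega> 2 (P a t)" "\<lambda>b. \<omega> 1 (P s b)"] le1 s t
    by simp
qed

text \<open>The last weight does not depend on the last variable, so it factors out of the inner sum
  and Cauchy--Schwarz discards it. Expanding the square pairs each remaining weight at
  \<open>u\<close> with its conjugate at \<open>v\<close>, and the phases combine to the frequency
  \<open>k * (u - v)\<close>.\<close>

lemma scaled_sum_Suc_sq_le:
  fixes \<omega> :: "nat \<Rightarrow> (nat \<Rightarrow> int) \<Rightarrow> complex"
  assumes w: "admissible_weights (Suc n) X \<omega>"
  defines "\<omega>' \<equiv> \<lambda>u v i x. \<omega> i (x(Suc n := u)) * cnj (\<omega> i (x(Suc n := v)))"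
  shows "(cmod (scaled_sum p k (Suc n) X \<omega>))\<^sup>2 \<le> (\<Prod>i=1..n. real (card (X i))) *
     (\<Sum>u\<in>X (Suc n). \<Sum>v\<in>X (Suc n). cmod (scaled_sum p (k * (u - v)) n X (\<omega>' u v)))"
\<comment> \<open>Nonemptiness supplies the point \<open>s\<close> at which the last coordinate of
  the last weight is frozen.\<close>
proof (cases "X (Suc n) = {}")
  case True
  thus ?thesis by (simp add: scaled_sum_def sum_PiE_Suc del: prod.cl_ivl_Suc One_nat_def)
next
  case False
  then obtain s where s: "s \<in> X (Suc n)" by blast
  define g where "g x t = (\<Prod>i=1..n. \<omega> i (x(Suc n := t))) * e_p p (k * ((\<Prod>i=1..n. x i) * t))"
    for x t
  have inv: "\<omega> (Suc n) (x(Suc n := t)) = \<omega> (Suc n) (x(Suc n := s))"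
    if "x \<in> PiE {1..n} X" "t \<in> X (Suc n)" for x t
  proof -
    have "\<omega> (Suc n) ((x(Suc n := t))(Suc n := s)) = \<omega> (Suc n) (x(Suc n := t))"
      by (rule admissible_weightsD(2)[OF w _ PiE_Suc_upd s]) (use that in auto)
    thus ?thesis by simp
  qed
  have le1: "cmod (\<omega> (Suc n) (x(Suc n := s))) \<le> 1" if "x \<in> PiE {1..n} X" for x
    by (rule admissible_weightsD(1)[OF w _ PiE_Suc_upd]) (use that s in auto)
  have prods: "(\<Prod>i=1..n. (x(Suc n := t)) i) = (\<Prod>i=1..n. x i)" for x :: "nat \<Rightarrow> int" and t
    by (rule prod.cong) auto
  have eq: "scaled_sum p k (Suc n) X \<omega>
      = (\<Sum>x\<in>PiE {1..n} X. \<omega> (Suc n) (x(Suc n := s)) * (\<Sum>t\<in>X (Suc n). g x t))"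
    unfolding scaled_sum_def sum_PiE_Suc sum_distrib_left
    by (intro sum.cong refl) (use inv in \<open>simp add: g_def prods mult_ac\<close>)
  have corr: "(\<Sum>x\<in>PiE {1..n} X. g x u * cnj (g x v))
      = scaled_sum p (k * (u - v)) n X (\<omega>' u v)" for u v
    unfolding scaled_sum_def
  proof (intro sum.cong refl)
    fix x
    have "g x u * cnj (g x v) = (\<Prod>i=1..n. \<omega>' u v i x) *
        (e_p p (k * ((\<Prod>i=1..n. x i) * u)) * cnj (e_p p (k * ((\<Prod>i=1..n. x i) * v))))"
      by (simp add: g_def \<omega>'_def prod.distrib)
    thus "g x u * cnj (g x v)
        = (\<Prod>i=1..n. \<omega>' u v i x) * e_p p (k * (u - v) * (\<Prod>i=1..n. x i))"
      unfolding e_p_mult_cnj by (simp add: algebra_simps)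
  qed
  from eq have "(cmod (scaled_sum p k (Suc n) X \<omega>))\<^sup>2
      \<le> real (card (PiE {1..n} X)) * (\<Sum>x\<in>PiE {1..n} X. (cmod (\<Sum>t\<in>X (Suc n). g x t))\<^sup>2)"
    using norm_sum_weighted_sq_le[of "PiE {1..n} X" "\<lambda>x. \<omega> (Suc n) (x(Suc n := s))"] le1
    by simp
  also have "\<dots> \<le> real (card (PiE {1..n} X)) * (\<Sum>u\<in>X (Suc n). \<Sum>v\<in>X (Suc n).
      cmod (\<Sum>x\<in>PiE {1..n} X. g x u * cnj (g x v)))"
    by (intro mult_left_mono sum_norm_sq_le_correlations) simp
  finally show ?thesis unfolding corr by (simp add: card_PiE)
qed

text \<open>Allows the induction to be applied to the correlations: for \<open>i \<le> n\<close>,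
  changing coordinate \<open>i\<close> commutes with fixing coordinate \<open>Suc n\<close>.\<close>

lemma admissible_weights_correlation:
  assumes w: "admissible_weights (Suc n) X \<omega>" and uv: "u \<in> X (Suc n)" "v \<in> X (Suc n)"
  shows "admissible_weights n X (\<lambda>i x. \<omega> i (x(Suc n := u)) * cnj (\<omega> i (x(Suc n := v))))"
  unfolding admissible_weights_def
proof (intro ballI conjI)
  fix i x assume i: "i \<in> {1..n}" and x: "x \<in> PiE {1..n} X"
  have *: "cmod (\<omega> i (x(Suc n := c))) \<le> 1"
    "\<And>t. t \<in> X i \<Longrightarrow> \<omega> i (x(i := t, Suc n := c)) = \<omega> i (x(Suc n := c))"
    if "c \<in> X (Suc n)" for c
  proof -
    have i': "i \<in> {1..Suc n}" "i \<noteq> Suc n" using i by auto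
    note w' = admissible_weightsD[OF w i'(1) PiE_Suc_upd[OF x that]]
    show "cmod (\<omega> i (x(Suc n := c))) \<le> 1" by (rule w'(1))
    fix t assume "t \<in> X i"
    hence "\<omega> i (x(Suc n := c, i := t)) = \<omega> i (x(Suc n := c))" by (rule w'(2))
    thus "\<omega> i (x(i := t, Suc n := c)) = \<omega> i (x(Suc n := c))"
      by (simp only: fun_upd_twist[OF i'(2)])
  qed
  show "cmod (\<omega> i (x(Suc n := u)) * cnj (\<omega> i (x(Suc n := v)))) \<le> 1"
    using *(1) uv by (auto simp: norm_mult intro!: mult_le_one)
  fix t assume "t \<in> X i"
  thus "\<omega> i ((x(i := t))(Suc n := u)) * cnj (\<omega> i ((x(i := t))(Suc n := v)))
      = \<omega> i (x(Suc n := u)) * cnj (\<omega> i (x(Suc n := v)))"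
    using *(2) uv by simp
qed

section \<open>Induction on the number of variables\<close>

lemma sqrt_powr_half_pow:
  assumes "x \<ge> (0::real)"
  shows "sqrt (x powr (1 / 2 ^ n)) = x powr (1 / 2 ^ Suc n)"
  using assms by (simp add: powr_half_sqrt[symmetric] powr_powr mult.commute)

text \<open>Each differencing step takes a square root and so halves both exponents, starting from
  exponent 1/2 for the bilinear saving. The uniform lower bound \<open>m\<close> on the sizes lets
  the diagonal losses of all steps collect in one power of \<open>1 / m\<close>. Differencing
  changes \<open>k\<close> and \<open>\<omega>\<close>, so both are generalised, while the sets stay
  fixed.\<close>

lemma scaled_sum_bound:
  fixes m :: real
  assumes p: "prime p" and n: "n \<ge> 2" and m: "m \<ge> 1"
  assumes "\<not> int p dvd k"
    and "\<And>i. i \<in> {1..n} \<Longrightarrow> X i \<subseteq> {0..<int p}"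
    and "\<And>i. i \<in> {1..n} \<Longrightarrow> real (card (X i)) \<ge> m"
    and "admissible_weights n X \<omega>"
  shows "cmod (scaled_sum p k n X \<omega>) \<le> (\<Prod>i=1..n. real (card (X i))) *
     (real n * (1 / m) powr (1 / 2 ^ n) +
      (real p / (real (card (X 1)) * real (card (X 2)))) powr (1 / 2 ^ (n - 1)))"
  using n assms(4-)
proof (induction n arbitrary: k \<omega> rule: dec_induct)
  case base
  have c: "card (X 1) > 0" "card (X 2) > 0"
    using base.prems(3)[of 1] base.prems(3)[of 2] m by auto
  let ?a = "real (card (X 1)) * real (card (X 2))"
  have "(cmod (scaled_sum p k 2 X \<omega>))\<^sup>2 \<le> real p * real (card (X 1)) * real (card (X 2))"
    using scaled_sum_2_bound[OF p base.prems(1,2,4)] c by force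
  also have "\<dots> = (?a * sqrt (real p / ?a))\<^sup>2"
    using c unfolding power_mult_distrib by (simp add: power2_eq_square)
  finally have "cmod (scaled_sum p k 2 X \<omega>) \<le> ?a * sqrt (real p / ?a)"
    by (rule power2_le_imp_le) simp
  \<comment> \<open>A nonnegative term in \<open>m\<close> is added to reach the shape of the
    induction hypothesis.\<close>
  also have "\<dots> \<le> ?a * (2 * (1 / m) powr (1 / 2 ^ 2) + sqrt (real p / ?a))"
    by (intro mult_left_mono) auto
  finally show ?case
    by (simp add: powr_half_sqrt numeral_2_eq_2)
next
  case (step n)
  define T where "T = X (Suc n)"
  define Q where "Q = (\<Prod>i=1..n. real (card (X i)))"
  define M where "M = (1 / m) powr (1 / 2 ^ n)"
  define R where "R = (real p / (real (card (X 1)) * real (card (X 2)))) powr (1 / 2 ^ (n - 1))"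
  define \<omega>' where "\<omega>' = (\<lambda>u v i x. \<omega> i (x(Suc n := u)) * cnj (\<omega> i (x(Suc n := v))))"
  have Q0: "Q \<ge> 0" by (simp add: Q_def prod_nonneg)
  have M0: "M \<ge> 0" and R0: "R \<ge> 0" by (auto simp: M_def R_def)
  have Tm: "real (card T) \<ge> m" using step.prems(3)[of "Suc n"] by (simp add: T_def)
  have T0: "card T > 0" using Tm m by linarith
  have finT: "finite T" using T0 card_gt_0_iff by blast
  have Tp: "T \<subseteq> {0..<int p}" using step.prems(2)[of "Suc n"] by (simp add: T_def)
  \<comment> \<open>The diagonal gets the trivial bound \<open>Q\<close>, the rest the induction
    hypothesis; adding the latter on the diagonal too gives one formula for all pairs.\<close>
  have summand: "cmod (scaled_sum p (k * (u - v)) n X (\<omega>' u v))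
      \<le> (if v = u then Q else 0) + Q * (real n * M + R)" if "u \<in> T" "v \<in> T" for u v
  proof -
    have w': "admissible_weights n X (\<omega>' u v)"
      unfolding \<omega>'_def using admissible_weights_correlation step.prems(4) that T_def by blast
    show ?thesis
    proof (cases "v = u")
      case True
      have "Q * (real n * M + R) \<ge> 0" using Q0 M0 R0 by simp
      moreover have "cmod (scaled_sum p (k * (u - v)) n X (\<omega>' u v)) \<le> Q"
        unfolding Q_def by (rule norm_scaled_sum_le[OF w'])
      ultimately show ?thesis using True by simp
    next
      case False
      hence "\<not> int p dvd k * (u - v)"
        using not_dvd_mult_diff[OF p step.prems(1)] that Tp by blast
      hence "cmod (scaled_sum p (k * (u - v)) n X (\<omega>' u v)) \<le> Q * (real n * M + R)"
        unfolding Q_def M_def R_def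
        by (rule step.IH) (use step.prems(2,3) w' in auto)
      thus ?thesis using False by simp
    qed
  qed
  have "(cmod (scaled_sum p k (Suc n) X \<omega>))\<^sup>2
      \<le> Q * (\<Sum>u\<in>T. \<Sum>v\<in>T. cmod (scaled_sum p (k * (u - v)) n X (\<omega>' u v)))"
    unfolding Q_def T_def \<omega>'_def by (rule scaled_sum_Suc_sq_le[OF step.prems(4)])
  also have "\<dots> \<le> Q * (\<Sum>u\<in>T. \<Sum>v\<in>T. (if v = u then Q else 0) + Q * (real n * M + R))"
    by (intro mult_left_mono sum_mono summand Q0)
  \<comment> \<open>The diagonal has \<open>card T\<close> of the \<open>(card T)\<^sup>2\<close>
    pairs, whence the relative loss \<open>1 / card T\<close>.\<close>
  also have "\<dots> = (Q * real (card T))\<^sup>2 * (1 / real (card T) + real n * M + R)"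
    using finT T0 by (simp add: sum.distrib field_simps power2_eq_square)
  also have "\<dots> \<le> (Q * real (card T))\<^sup>2 * (real (Suc n) * M + R)"
  proof (intro mult_left_mono)
    \<comment> \<open>Since \<open>1 / m \<le> 1\<close>, the diagonal loss is at most one further
      copy of \<open>M\<close>; this raises the coefficient from \<open>n\<close> to
      \<open>Suc n\<close>.\<close>
    have "1 / real (card T) \<le> 1 / m" using Tm m by (simp add: frac_le)
    also have "\<dots> = (1 / m) powr 1" using m by simp
    also have "\<dots> \<le> M" unfolding M_def using m by (intro powr_mono') auto
    finally show "1 / real (card T) + real n * M + R \<le> real (Suc n) * M + R"
      by (simp add: algebra_simps)
  qed simp
  finally have "cmod (scaled_sum p k (Suc n) X \<omega>)
      \<le> sqrt ((Q * real (card T))\<^sup>2 * (real (Suc n) * M + R))"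
    by (simp add: real_le_rsqrt)
  also have "\<dots> = Q * real (card T) * sqrt (real (Suc n) * M + R)"
    using Q0 by (simp add: real_sqrt_mult)
  also have "\<dots> \<le> Q * real (card T) * (real (Suc n) * sqrt M + sqrt R)"
  proof (intro mult_left_mono)
    have "sqrt (real (Suc n) * M + R) \<le> sqrt (real (Suc n)) * sqrt M + sqrt R"
      using sqrt_add_le_add_sqrt[of "real (Suc n) * M" R] M0 R0 by (simp add: real_sqrt_mult)
    \<comment> \<open>A generous estimate that keeps the coefficient equal to the number of
      variables.\<close>
    also have "sqrt (real (Suc n)) \<le> real (Suc n)"
      by (intro real_le_lsqrt) (auto simp: power2_eq_square)
    finally show "sqrt (real (Suc n) * M + R) \<le> real (Suc n) * sqrt M + sqrt R"
      using M0 by (simp add: mult_right_mono)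
  qed (use Q0 in simp)
  also have "sqrt M = (1 / m) powr (1 / 2 ^ Suc n)"
    unfolding M_def using m by (intro sqrt_powr_half_pow) simp
  also have "sqrt R = (real p / (real (card (X 1)) * real (card (X 2)))) powr (1 / 2 ^ (Suc n - 1))"
  proof -
    \<comment> \<open>Subtraction is truncated, so this uses \<open>n > 0\<close>.\<close>
    have "Suc n - 1 = Suc (n - 1)" using step.hyps by simp
    thus ?thesis unfolding R_def by (simp only:) (intro sqrt_powr_half_pow, simp)
  qed
  finally show ?case by (simp add: Q_def T_def)
qed

section \<open>Geometric means and the final bound\<close>

text \<open>Every later factor is at most both \<open>a 1\<close> and \<open>a 2\<close>, hence at
  most \<open>sqrt (a 1 * a 2)\<close>; the whole product is then at most the \<open>n\<close>-th
  power of this root.\<close>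

lemma geometric_mean_sq_le_two_largest:
  fixes a :: "nat \<Rightarrow> real"
  assumes n: "n \<ge> 2" and pos: "\<And>i. i \<in> {1..n} \<Longrightarrow> a i > 0"
    and dec: "\<And>i j. i \<in> {1..n} \<Longrightarrow> j \<in> {1..n} \<Longrightarrow> i \<le> j \<Longrightarrow> a j \<le> a i"
  shows "((\<Prod>i=1..n. a i) powr (1 / real n))\<^sup>2 \<le> a 1 * a 2"
proof -
  have pos12: "a 1 > 0" "a 2 > 0" "a 2 \<le> a 1" using pos[of 1] pos[of 2] dec[of 1 2] n by auto
  have split: "{1..n} = insert 1 (insert 2 {3..n})" using n by auto
  have "(\<Prod>i=1..n. a i) = a 1 * a 2 * (\<Prod>i=3..n. a i)"
    unfolding split by simp
  also have "\<dots> \<le> a 1 * a 2 * (\<Prod>i=3..n. sqrt (a 1 * a 2))"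
  proof (intro mult_left_mono prod_mono conjI)
    fix i assume i: "i \<in> {3..n}"
    show "a i \<ge> 0" using pos[of i] i by auto
    have "a i \<le> a 1" "a i \<le> a 2" using dec[of 1 i] dec[of 2 i] i by auto
    thus "a i \<le> sqrt (a 1 * a 2)"
      using \<open>a i \<ge> 0\<close> by (intro real_le_rsqrt) (auto simp: power2_eq_square intro: mult_mono)
  qed (use pos12 in auto)
  also have "\<dots> = sqrt (a 1 * a 2) ^ 2 * sqrt (a 1 * a 2) ^ (n - 2)"
    using pos12 by simp
  also have "\<dots> = sqrt (a 1 * a 2) ^ n"
    unfolding power_add[symmetric] using n by (simp only: le_add_diff_inverse)
  also have "\<dots> = sqrt (a 1 * a 2) powr real n"
    using pos12 by (simp add: powr_realpow)
  finally have "(\<Prod>i=1..n. a i) powr (1 / real n) \<le> (sqrt (a 1 * a 2) powr real n) powr (1 / real n)"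
    using pos by (intro powr_mono2 prod_nonneg) (auto simp: less_imp_le)
  also have "\<dots> = sqrt (a 1 * a 2)"
    using n pos12 by (simp add: powr_powr)
  finally have "((\<Prod>i=1..n. a i) powr (1 / real n))\<^sup>2 \<le> (sqrt (a 1 * a 2))\<^sup>2"
    by (intro power_mono) auto
  thus ?thesis using pos12 by simp
qed

text \<open>Ensures that the ratio of \<open>sqrt p\<close> to the geometric mean is at most 1, so
  that lowering its exponent only weakens a bound.\<close>

lemma geometric_mean_ge:
  fixes a :: "nat \<Rightarrow> real"
  assumes "n \<ge> 1" "b > 0" "\<And>i. i \<in> {1..n} \<Longrightarrow> a i \<ge> b"
  shows "(\<Prod>i=1..n. a i) powr (1 / real n) \<ge> b"
proof -
  have "b ^ n = (\<Prod>i=1..n. b)" by simp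
  also have "\<dots> \<le> (\<Prod>i=1..n. a i)" using assms by (intro prod_mono) auto
  finally have "(b powr real n) powr (1 / real n) \<le> (\<Prod>i=1..n. a i) powr (1 / real n)"
    using assms by (intro powr_mono2) (auto simp: powr_realpow)
  thus ?thesis using assms by (simp add: powr_powr)
qed

text \<open>The induction is applied with \<open>k = 1\<close> and \<open>m\<close> the smallest
  size \<open>card (X n)\<close>; the product of the two largest sizes is then replaced by the
  squared geometric mean \<open>G\<close>.\<close>

lemma multilinear_sum_bound:
  assumes p: "prime p" and n: "n \<ge> 2"
    and X: "\<And>i. i \<in> {1..n} \<Longrightarrow> X i \<subseteq> {0..<int p}"
    and dec: "\<And>i j. i \<in> {1..n} \<Longrightarrow> j \<in> {1..n} \<Longrightarrow> i \<le> j \<Longrightarrow> card (X j) \<le> card (X i)"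
    and big: "\<And>i. i \<in> {1..n} \<Longrightarrow> real (card (X i)) \<ge> sqrt (real p)"
    and w: "admissible_weights n X \<omega>"
  shows "cmod (multilinear_sum p n X \<omega>) \<le> (\<Prod>i=1..n. real (card (X i))) *
     (real n * (1 / real (card (X n)) powr (1 / 2 ^ n)) +
      (sqrt (real p) / (\<Prod>i=1..n. real (card (X i))) powr (1 / real n)) powr (1 / 2 ^ n))"
proof -
  define G where "G = (\<Prod>i=1..n. real (card (X i))) powr (1 / real n)"
  define m where "m = real (card (X n))"
  have p1: "real p > 1" using prime_gt_1_nat[OF p] by simp
  have pos: "real (card (X i)) > 0" if "i \<in> {1..n}" for i
    using big[OF that] p1 by (smt (verit) real_sqrt_gt_0_iff)
  have m1: "m \<ge> 1" using pos[of n] n by (simp add: m_def)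
  have Gp: "G \<ge> sqrt (real p)"
    unfolding G_def using n p1 big by (intro geometric_mean_ge) auto
  hence G0: "G > 0" using p1 by (smt (verit) real_sqrt_gt_0_iff)
  have G2: "G\<^sup>2 \<le> real (card (X 1)) * real (card (X 2))"
    unfolding G_def using n pos dec by (intro geometric_mean_sq_le_two_largest) auto
  have k: "\<not> int p dvd 1" using p1 by simp
  have "multilinear_sum p n X \<omega> = scaled_sum p 1 n X \<omega>"
    by (simp add: multilinear_sum_def scaled_sum_def)
  hence "cmod (multilinear_sum p n X \<omega>) \<le> (\<Prod>i=1..n. real (card (X i))) *
     (real n * (1 / m) powr (1 / 2 ^ n) +
      (real p / (real (card (X 1)) * real (card (X 2)))) powr (1 / 2 ^ (n - 1)))"
    using scaled_sum_bound[OF p n m1 k X _ w] dec n by (simp add: m_def)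
  also have "\<dots> \<le> (\<Prod>i=1..n. real (card (X i))) *
     (real n * (1 / m powr (1 / 2 ^ n)) + (sqrt (real p) / G) powr (1 / 2 ^ n))"
  proof (intro mult_left_mono add_mono)
    show "(1 / m) powr (1 / 2 ^ n) \<le> 1 / m powr (1 / 2 ^ n)"
      using m1 by (simp add: powr_divide)
    have "real p / (real (card (X 1)) * real (card (X 2))) \<le> real p / G\<^sup>2"
      using G2 G0 by (intro frac_le) auto
    also have "\<dots> = (sqrt (real p) / G) powr 2"
      using G0 by (simp add: power_divide)
    finally have "(real p / (real (card (X 1)) * real (card (X 2)))) powr (1 / 2 ^ (n - 1))
        \<le> ((sqrt (real p) / G) powr 2) powr (1 / 2 ^ (n - 1))"
      by (intro powr_mono2) auto
    also have "\<dots> = (sqrt (real p) / G) powr (2 / 2 ^ (n - 1))"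
      by (simp add: powr_powr)
    \<comment> \<open>The exponent reached is four times the one claimed, and the base is at most 1
      because \<open>G \<ge> sqrt p\<close>.\<close>
    also have "\<dots> \<le> (sqrt (real p) / G) powr (1 / 2 ^ n)"
    proof (rule powr_mono')
      have "(2::real) ^ (n - 1) \<le> 2 ^ n" by (intro power_increasing) auto
      thus "1 / 2 ^ n \<le> 2 / (2::real) ^ (n - 1)" by (intro frac_le) auto
    qed (use Gp G0 in auto)
    finally show "(real p / (real (card (X 1)) * real (card (X 2)))) powr (1 / 2 ^ (n - 1))
        \<le> (sqrt (real p) / G) powr (1 / 2 ^ n)" .
  qed (auto intro: prod_nonneg)
  finally show ?thesis by (simp add: G_def m_def)
qed

theorem theorem1p2:
  shows "\<exists>\<epsilon> :: nat \<Rightarrow> real. \<epsilon> \<longlonglongrightarrow> 0 \<and>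
    (\<forall>n::nat. n \<ge> 2 \<longrightarrow>
      (\<exists>c::real. c > 0 \<and>
        (\<forall>(p::nat) (X :: nat \<Rightarrow> int set) (\<omega> :: nat \<Rightarrow> (nat \<Rightarrow> int) \<Rightarrow> complex).
          prime p \<longrightarrow>
          (\<forall>i\<in>{1..n}. X i \<subseteq> carrier (residue_ring (int p))) \<longrightarrow>
          (\<forall>i\<in>{1..n}. \<forall>j\<in>{1..n}. i \<le> j \<longrightarrow> card (X j) \<le> card (X i)) \<longrightarrow>
          (\<forall>i\<in>{1..n}. real (card (X i)) \<ge> real p powr (1/2 + 1 / (2 ^ (n+1) - 6))) \<longrightarrow>
          admissible_weights n X \<omega> \<longrightarrow>
          cmod (multilinear_sum p n X \<omega>)
            \<le> c * ((\<Prod>i=1..n. real (card (X i))) *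
                 ((\<Sum>i=1..n. 1 / real (card (X i)) powr (1 / 2 ^ i)) +
                  real p powr \<epsilon> p *
                    (real p powr (1/2) / (\<Prod>i=1..n. real (card (X i))) powr (1 / real n))
                      powr (1 / 2 ^ n))))))"
proof (intro exI[of _ "\<lambda>_. 0"] conjI allI impI)
  fix n :: nat assume n: "n \<ge> 2"
  show "\<exists>c::real. c > 0 \<and>
        (\<forall>(p::nat) (X :: nat \<Rightarrow> int set) (\<omega> :: nat \<Rightarrow> (nat \<Rightarrow> int) \<Rightarrow> complex).
          prime p \<longrightarrow>
          (\<forall>i\<in>{1..n}. X i \<subseteq> carrier (residue_ring (int p))) \<longrightarrow>
          (\<forall>i\<in>{1..n}. \<forall>j\<in>{1..n}. i \<le> j \<longrightarrow> card (X j) \<le> card (X i)) \<longrightarrow>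
          (\<forall>i\<in>{1..n}. real (card (X i)) \<ge> real p powr (1/2 + 1 / (2 ^ (n+1) - 6))) \<longrightarrow>
          admissible_weights n X \<omega> \<longrightarrow>
          cmod (multilinear_sum p n X \<omega>)
            \<le> c * ((\<Prod>i=1..n. real (card (X i))) *
                 ((\<Sum>i=1..n. 1 / real (card (X i)) powr (1 / 2 ^ i)) +
                  real p powr 0 *
                    (real p powr (1/2) / (\<Prod>i=1..n. real (card (X i))) powr (1 / real n))
                      powr (1 / 2 ^ n))))"
  \<comment> \<open>The constant is the coefficient of the diagonal term.\<close>
  proof (intro exI[of _ "real n"] conjI allI impI)
    show "real n > 0" using n by simp
    fix p :: nat and X :: "nat \<Rightarrow> int set" and \<omega> :: "nat \<Rightarrow> (nat \<Rightarrow> int) \<Rightarrow> complex"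
    assume p: "prime p"
      and X: "\<forall>i\<in>{1..n}. X i \<subseteq> carrier (residue_ring (int p))"
      and dec: "\<forall>i\<in>{1..n}. \<forall>j\<in>{1..n}. i \<le> j \<longrightarrow> card (X j) \<le> card (X i)"
      and big: "\<forall>i\<in>{1..n}. real (card (X i)) \<ge> real p powr (1/2 + 1 / (2 ^ (n+1) - 6))"
      and w: "admissible_weights n X \<omega>"
    define V where "V = (\<Prod>i=1..n. real (card (X i)))"
    define D where "D = (\<Sum>i=1..n. 1 / real (card (X i)) powr (1 / 2 ^ i))"
    define E where "E = (sqrt (real p) / V powr (1 / real n)) powr (1 / 2 ^ n)"
    have p1: "real p > 1" using prime_gt_1_nat[OF p] by simp
    \<comment> \<open>For \<open>n \<ge> 2\<close> the denominator \<open>2 ^ (n+1) - 6\<close> is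
      at least 2, so the exponent in the size condition exceeds 1/2.\<close>
    have "(2::real) ^ (n + 1) \<ge> 2 ^ 3" using n by (intro power_increasing) auto
    hence "sqrt (real p) \<le> real p powr (1/2 + 1 / (2 ^ (n+1) - 6))"
      using p1 by (simp add: powr_half_sqrt[symmetric])
    hence big': "real (card (X i)) \<ge> sqrt (real p)" if "i \<in> {1..n}" for i
      using big that by force
    have Xp: "X i \<subseteq> {0..<int p}" if "i \<in> {1..n}" for i
      using X[rule_format, OF that] by (auto simp: residue_ring_def)
    have "cmod (multilinear_sum p n X \<omega>)
        \<le> V * (real n * (1 / real (card (X n)) powr (1 / 2 ^ n)) + E)"
      unfolding V_def E_def
      by (rule multilinear_sum_bound[OF p n Xp _ big' w]) (use dec in auto)
    also have "\<dots> \<le> V * (real n * D + real n * E)"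
    proof (intro mult_left_mono add_mono)
      \<comment> \<open>The diagonal term is exactly the summand \<open>i = n\<close> of
        \<open>D\<close>.\<close>
      show "1 / real (card (X n)) powr (1 / 2 ^ n) \<le> D"
        unfolding D_def using n
        by (intro member_le_sum[of n _ "\<lambda>i. 1 / real (card (X i)) powr (1 / 2 ^ i)"]) auto
      show "E \<le> real n * E" using n by (simp add: E_def mult_le_cancel_right1)
    qed (auto simp: V_def intro: prod_nonneg)
    also have "\<dots> = real n * (V * (D + real p powr 0 * E))"
      using p1 by (simp add: algebra_simps)
    finally show "cmod (multilinear_sum p n X \<omega>)
            \<le> real n * ((\<Prod>i=1..n. real (card (X i))) *
                 ((\<Sum>i=1..n. 1 / real (card (X i)) powr (1 / 2 ^ i)) +
                  real p powr 0 *
                    (real p powr (1/2) / (\<Prod>i=1..n. real (card (X i))) powr (1 / real n))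
                      powr (1 / 2 ^ n)))"
      by (simp add: V_def D_def E_def powr_half_sqrt)
  qed
qed simp

end
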